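(* For a policy $\pi$ define $V_{s,t}^\pi$ ($0\le s\le t\le T$) by $V_{s,T}^\pi(h_T)=g(h_T)$ and, for $t<T$, $$V_{s,t}^{\pi}(h_t)=r_t(h_t,\pi_t(h_t))+\beta\inf_{q\in\mathcal K_{s,t}(h_t,\pi_t(h_t))}\sum_yq(y)V_{s,t+1}^{\pi}(h_t,\pi_t(h_t),y),$$ and define $$Q_t^{s,\pi}(h_t,a)=r_t(h_t,a)+\beta\inf_{q\in\mathcal K_{s,t}(h_t,a)}\sum_yq(y)V_{s,t+1}^{\pi}(h_t,a,y).$$ Then a policy $\pi^*$ is a reconstructed-ambiguity subgame-perfect equilibrium (SPE) if and only if the family $\{V_{s,t}^{\pi^*}:0\le s\le t\le T\}$ determined by $V_{s,T}^{\pi^*}(h_T)=g(h_T)$ and, for $t<T$, $V_{s,t}^{\pi^*}(h_t)=r_t(h_t,\pi_t^*(h_t))+\beta\inf_{q\in\mathcal K_{s,t}(h_t,\pi_t^*(h_t))}\sum_yq(y)V_{s,t+1}^{\pi^*}(h_t,\pi_t^*(h_t),y)$, with the associated action values $Q_t^{t,\pi^*}(h_t,a)=r_t(h_t,a)+\beta\inf_{q\in\mathcal K_{t,t}(h_t,a)}\sum_yq(y)V_{t,t+1}^{\pi^*}(h_t,a,y)$, satisfies $$\pi_t^*(h_t)\in\operatorname*{arg\,max}_{a\in\mathcal A_t(h_t)}Q_t^{t,\pi^*}(h_t,a)$$ for every date $t<T$ and every history $h_t$.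
   Context: Finite controlled event tree: dates $t=0,\dots,T$; a finite set $\mathcal H_t$ of histories at date $t$; at each $h_t$ with $t<T$ a finite nonempty action set $\mathcal A_t(h_t)$; after action $a$, an observation $y$ in a finite set $\mathcal Y_{t+1}(h_t,a)$, leading to the history $(h_t,a,y)\in\mathcal H_{t+1}$. Rewards $r_t(h_t,a)$ and terminal reward $g(h_T)$ are bounded reals; $\beta\in(0,1]$. For each $0\le s\le t<T$, $h_t$, $a$ there is a nonempty compact set $\mathcal K_{s,t}(h_t,a)\subseteq\Delta(\mathcal Y_{t+1}(h_t,a))$, the one-step kernels that evaluator "vintage" $s$ uses at date $t$; $\mathcal K_{t,t}$ is the fresh date-$t$ correspondence. A policy is $\pi=(\pi_t)_{t<T}$ with $\pi_t(h_t)\in\mathcal A_t(h_t)$. Vintages are rectangularized: the vintage-$s$ robust evaluation, at $h_t$, of a continuation plan (an action now followed by a policy) is the infimum of the expected discounted reward $E[\sum_{j=t}^{T-1}\beta^{j-t}r_j+\beta^{T-t}g]$ over all path laws obtained by selecting, independently at every descendant history $h_j$ ($j\ge t$), a one-step kernel from $\mathcal K_{s,j}(h_j,\cdot)$ evaluated at the action the plan takes at $h_j$. The fresh robust evaluation of self $t$ is the vintage-$t$ evaluation. A policy $\pi^*$ is an SPE if at every history $h_t$, $t<T$, the action $\pi^*_t(h_t)$ maximizes self $t$'s fresh robust evaluation among all one-period deviations $a\in\mathcal A_t(h_t)$, taking the future policy $\pi^*_{t+1},\dots,\pi^*_{T-1}$ as given. *)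

theory Defs
  imports "HOL-Probability.Probability"
begin

text \<open>A date-\<open>(t+1)\<close> history is literally the triple \<open>(h, a, y)\<close> of its predecessor, the action and
  the observation; \<open>Root\<close> wraps histories that are not of this form, in particular the initial ones.\<close>

datatype ('x, 'a, 'y) history = Root 'x | Node "('x, 'a, 'y) history" 'a 'y

text \<open>\<open>observations M (Suc t) h a\<close> are the observations that can follow \<open>a\<close> at the date-\<open>t\<close> history
  \<open>h\<close>; \<open>kernels M s t h a\<close> are the one-step kernels of vintage \<open>s\<close> at date \<open>t\<close>.\<close>

record ('x, 'a, 'y) ambiguity_model =
  horizon :: nat
  histories :: "nat \<Rightarrow> ('x, 'a, 'y) history set"
  actions :: "nat \<Rightarrow> ('x, 'a, 'y) history \<Rightarrow> 'a set"
  observations :: "nat \<Rightarrow> ('x, 'a, 'y) history \<Rightarrow> 'a \<Rightarrow> 'y set"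
  reward :: "nat \<Rightarrow> ('x, 'a, 'y) history \<Rightarrow> 'a \<Rightarrow> real"
  final_reward :: "('x, 'a, 'y) history \<Rightarrow> real"
  discount :: real
  kernels :: "nat \<Rightarrow> nat \<Rightarrow> ('x, 'a, 'y) history \<Rightarrow> 'a \<Rightarrow> 'y pmf set"

text \<open>Compactness of a set of kernels is compactness of the set of mass functions for pointwise
  convergence. As all of them vanish off one finite set, this is the Euclidean topology of the simplex.
  Rewards are real-valued on finite sets, hence bounded.\<close>

locale event_tree =
  fixes M :: "('x, 'a, 'y) ambiguity_model"
  assumes finite_histories: "t \<le> horizon M \<Longrightarrow> finite (histories M t)"
    and finite_actions:
      "\<lbrakk>t < horizon M; h \<in> histories M t\<rbrakk> \<Longrightarrow> finite (actions M t h)"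
    and actions_nonempty:
      "\<lbrakk>t < horizon M; h \<in> histories M t\<rbrakk> \<Longrightarrow> actions M t h \<noteq> {}"
    and finite_observations:
      "\<lbrakk>t < horizon M; h \<in> histories M t; a \<in> actions M t h\<rbrakk>
        \<Longrightarrow> finite (observations M (Suc t) h a)"
    and successor:
      "\<lbrakk>t < horizon M; h \<in> histories M t; a \<in> actions M t h; y \<in> observations M (Suc t) h a\<rbrakk>
        \<Longrightarrow> Node h a y \<in> histories M (Suc t)"
    and discount_pos: "0 < discount M"
    and discount_le_1: "discount M \<le> 1"
    and kernels_nonempty:
      "\<lbrakk>s \<le> t; t < horizon M; h \<in> histories M t; a \<in> actions M t h\<rbrakk> \<Longrightarrow> kernels M s t h a \<noteq> {}"
    and kernels_support:
      "\<lbrakk>s \<le> t; t < horizon M; h \<in> histories M t; a \<in> actions M t h; q \<in> kernels M s t h a\<rbrakk>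
        \<Longrightarrow> set_pmf q \<subseteq> observations M (Suc t) h a"
    and kernels_compact:
      "\<lbrakk>s \<le> t; t < horizon M; h \<in> histories M t; a \<in> actions M t h\<rbrakk>
        \<Longrightarrow> compact (pmf ` kernels M s t h a)"

type_synonym ('x, 'a, 'y) policy = "nat \<Rightarrow> ('x, 'a, 'y) history \<Rightarrow> 'a"

definition is_policy :: "('x, 'a, 'y) ambiguity_model \<Rightarrow> ('x, 'a, 'y) policy \<Rightarrow> bool" where
  "is_policy M \<pi> \<longleftrightarrow> (\<forall>t<horizon M. \<forall>h\<in>histories M t. \<pi> t h \<in> actions M t h)"

text \<open>The pairs \<open>(j, h')\<close> such that \<open>h'\<close> is a date-\<open>j\<close> descendant of the date-\<open>t\<close> history \<open>h\<close>,
  which counts as its own descendant.\<close>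

inductive_set descendants ::
    "('x, 'a, 'y) ambiguity_model \<Rightarrow> nat \<Rightarrow> ('x, 'a, 'y) history \<Rightarrow> (nat \<times> ('x, 'a, 'y) history) set"
  for M t h where
  here: "(t, h) \<in> descendants M t h"
| step: "\<lbrakk>(j, h') \<in> descendants M t h; j < horizon M; a \<in> actions M j h';
          y \<in> observations M (Suc j) h' a\<rbrakk>
        \<Longrightarrow> (Suc j, Node h' a y) \<in> descendants M t h"

text \<open>The independent selections of one kernel of vintage \<open>s\<close> at each descendant of \<open>h\<close>, given that
  actions follow the plan \<open>\<sigma>\<close>.\<close>

definition selections ::
    "('x, 'a, 'y) ambiguity_model \<Rightarrow> nat \<Rightarrow> nat \<Rightarrow> ('x, 'a, 'y) history \<Rightarrow> ('x, 'a, 'y) policy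
      \<Rightarrow> (nat \<Rightarrow> ('x, 'a, 'y) history \<Rightarrow> 'y pmf) set" where
  "selections M s t h \<sigma> =
    {\<kappa>. \<forall>(j, h')\<in>descendants M t h. j < horizon M \<longrightarrow> \<kappa> j h' \<in> kernels M s j h' (\<sigma> j h')}"

text \<open>Law of the list of histories visited at dates \<open>t, \<dots>, t + n\<close>, starting from \<open>h\<close> at date \<open>t\<close>.\<close>

primrec path_law ::
    "('x, 'a, 'y) policy \<Rightarrow> (nat \<Rightarrow> ('x, 'a, 'y) history \<Rightarrow> 'y pmf) \<Rightarrow> nat \<Rightarrow> nat
      \<Rightarrow> ('x, 'a, 'y) history \<Rightarrow> ('x, 'a, 'y) history list pmf" where
  "path_law \<sigma> \<kappa> 0 t h = return_pmf [h]"
| "path_law \<sigma> \<kappa> (Suc n) t h =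
    bind_pmf (\<kappa> t h) (\<lambda>y. map_pmf ((#) h) (path_law \<sigma> \<kappa> n (Suc t) (Node h (\<sigma> t h) y)))"

text \<open>Discounted reward of a path \<open>p\<close> started at date \<open>t\<close>; the date-\<open>j\<close> history on it is
  \<open>p ! (j - t)\<close>.\<close>

definition path_reward ::
    "('x, 'a, 'y) ambiguity_model \<Rightarrow> ('x, 'a, 'y) policy \<Rightarrow> nat \<Rightarrow> ('x, 'a, 'y) history list \<Rightarrow> real" where
  "path_reward M \<sigma> t p =
    (\<Sum>j\<in>{t..<horizon M}. discount M ^ (j - t) * reward M j (p ! (j - t)) (\<sigma> j (p ! (j - t))))
      + discount M ^ (horizon M - t) * final_reward M (p ! (horizon M - t))"

definition robust_evaluation ::
    "('x, 'a, 'y) ambiguity_model \<Rightarrow> nat \<Rightarrow> nat \<Rightarrow> ('x, 'a, 'y) history \<Rightarrow> ('x, 'a, 'y) policy \<Rightarrow> real" where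
  "robust_evaluation M s t h \<sigma> =
    (INF \<kappa>\<in>selections M s t h \<sigma>.
      measure_pmf.expectation (path_law \<sigma> \<kappa> (horizon M - t) t h) (path_reward M \<sigma> t))"

text \<open>The plan of taking \<open>a\<close> at the date-\<open>t\<close> history \<open>h\<close> and following \<open>\<pi>\<close> afterwards.\<close>

definition deviation ::
    "('x, 'a, 'y) policy \<Rightarrow> nat \<Rightarrow> ('x, 'a, 'y) history \<Rightarrow> 'a \<Rightarrow> ('x, 'a, 'y) policy" where
  "deviation \<pi> t h a = \<pi>(t := (\<pi> t)(h := a))"

definition SPE :: "('x, 'a, 'y) ambiguity_model \<Rightarrow> ('x, 'a, 'y) policy \<Rightarrow> bool" where
  "SPE M \<pi> \<longleftrightarrow>
    (\<forall>t<horizon M. \<forall>h\<in>histories M t.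
      is_arg_max (\<lambda>a. robust_evaluation M t t h (deviation \<pi> t h a)) (\<lambda>a. a \<in> actions M t h) (\<pi> t h))"

function V ::
    "('x, 'a, 'y) ambiguity_model \<Rightarrow> ('x, 'a, 'y) policy \<Rightarrow> nat \<Rightarrow> nat \<Rightarrow> ('x, 'a, 'y) history \<Rightarrow> real" where
  "V M \<pi> s t h =
    (if t < horizon M then
       reward M t h (\<pi> t h) + discount M *
         (INF q\<in>kernels M s t h (\<pi> t h).
           \<Sum>y\<in>observations M (Suc t) h (\<pi> t h). pmf q y * V M \<pi> s (Suc t) (Node h (\<pi> t h) y))
     else final_reward M h)"
  by pat_completeness auto
termination
  by (relation "Wellfounded.measure (\<lambda>(M, \<pi>, s, t, h). horizon M - t)") auto

declare V.simps [simp del]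

definition Q ::
    "('x, 'a, 'y) ambiguity_model \<Rightarrow> ('x, 'a, 'y) policy \<Rightarrow> nat \<Rightarrow> nat \<Rightarrow> ('x, 'a, 'y) history \<Rightarrow> 'a \<Rightarrow> real" where
  "Q M \<pi> s t h a =
    reward M t h a + discount M *
      (INF q\<in>kernels M s t h a.
        \<Sum>y\<in>observations M (Suc t) h a. pmf q y * V M \<pi> s (Suc t) (Node h a y))"

end

theory Submission imports Defs begin

text \<open>The equilibrium condition compares robust evaluations, i.e. infima over whole path laws, whereas
  the fixed-point condition compares the one-step recursive values \<open>Q\<close>. The two agree, action by
  action, because the selections are rectangular: each descendant history contributes its own kernel,
  so the infimum over path laws can be computed by backward induction. This is
  \<open>robust_evaluation_eq_V\<close>, and it has two halves.

  Every admissible selection yields at least \<open>V\<close> (\<open>V_le_expected_reward\<close>): at each date the selected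
  kernel is one of those over which \<open>V\<close> takes its infimum, and the weights \<open>pmf q y\<close> and the discount
  factor are nonnegative. Conversely, compactness makes each of these one-step infima a minimum.
  Collecting a minimising kernel at every history gives one selection that attains \<open>V\<close> at all
  histories simultaneously (\<open>expected_reward_worst_kernel\<close>).

  A one-period deviation is itself a policy. Its value \<open>V\<close> at the deviation history is the \<open>Q\<close> value
  of the deviating action, since continuation values only look at later dates, at which the deviation
  agrees with the original policy.\<close>

section \<open>Path rewards, selections and deviations\<close>

definition expected_reward ::
    "('x, 'a, 'y) ambiguity_model \<Rightarrow> ('x, 'a, 'y) policy \<Rightarrow> (nat \<Rightarrow> ('x, 'a, 'y) history \<Rightarrow> 'y pmf)
      \<Rightarrow> nat \<Rightarrow> ('x, 'a, 'y) history \<Rightarrow> real" where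
  "expected_reward M \<sigma> \<kappa> t h =
    measure_pmf.expectation (path_law \<sigma> \<kappa> (horizon M - t) t h) (path_reward M \<sigma> t)"

lemma path_reward_Cons:
  assumes "t < horizon M"
  shows "path_reward M \<sigma> t (h # p) =
    reward M t h (\<sigma> t h) + discount M * path_reward M \<sigma> (Suc t) p"
proof -
  have shift: "j - t = Suc (j - Suc t)" if "Suc t \<le> j" for j
    using that by simp
  have "(\<Sum>j\<in>{t..<horizon M}. discount M ^ (j - t) * reward M j ((h # p) ! (j - t))
          (\<sigma> j ((h # p) ! (j - t)))) =
      reward M t h (\<sigma> t h) + (\<Sum>j\<in>{Suc t..<horizon M}. discount M *
        (discount M ^ (j - Suc t) * reward M j (p ! (j - Suc t)) (\<sigma> j (p ! (j - Suc t)))))"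
    using assms
    by (subst sum.atLeast_Suc_lessThan) (auto intro!: sum.cong simp: shift)
  moreover have "horizon M - t = Suc (horizon M - Suc t)"
    using assms by simp
  ultimately show ?thesis
    by (simp add: path_reward_def sum_distrib_left algebra_simps)
qed

lemma descendants_successor:
  assumes "(j, h') \<in> descendants M (Suc t) (Node h a y)"
    and "t < horizon M" "a \<in> actions M t h" "y \<in> observations M (Suc t) h a"
  shows "(j, h') \<in> descendants M t h"
  using assms(1)
proof (induction rule: descendants.induct)
  case here
  show ?case
    by (rule descendants.step[OF descendants.here assms(2-4)])
next
  case (step j h' a' y')
  then show ?case
    by (intro descendants.step)
qed

lemma selections_successor:
  assumes "\<kappa> \<in> selections M s t h \<sigma>"
    and "t < horizon M" "\<sigma> t h \<in> actions M t h" "y \<in> observations M (Suc t) h (\<sigma> t h)"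
  shows "\<kappa> \<in> selections M s (Suc t) (Node h (\<sigma> t h) y) \<sigma>"
  using assms(1) descendants_successor[OF _ assms(2-4)]
  by (auto simp: selections_def)

lemma selections_kernel:
  assumes "\<kappa> \<in> selections M s t h \<sigma>" "t < horizon M"
  shows "\<kappa> t h \<in> kernels M s t h (\<sigma> t h)"
  using assms descendants.here[of t h M] by (auto simp: selections_def)

lemma V_cong:
  assumes "\<And>j. t \<le> j \<Longrightarrow> \<sigma> j = \<sigma>' j"
  shows "V M \<sigma> s t h = V M \<sigma>' s t h"
  using assms
proof (induction "horizon M - t" arbitrary: t h)
  case 0
  then show ?case
    by (simp add: V.simps)
next
  case (Suc n)
  have "V M \<sigma> s (Suc t) h' = V M \<sigma>' s (Suc t) h'" for h'
    using Suc.hyps(2) by (intro Suc.hyps(1) Suc.prems) auto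
  then show ?case
    using Suc.prems[of t] by (subst (1 2) V.simps) simp
qed

lemma V_deviation:
  assumes "t < horizon M"
  shows "V M (deviation \<pi> t h a) s t h = Q M \<pi> s t h a"
proof -
  have "V M (deviation \<pi> t h a) s (Suc t) h' = V M \<pi> s (Suc t) h'" for h'
    by (rule V_cong) (simp add: deviation_def)
  moreover have "deviation \<pi> t h a t h = a"
    by (simp add: deviation_def)
  ultimately show ?thesis
    using assms by (subst V.simps) (simp add: Q_def)
qed

lemma is_policy_deviation:
  assumes "is_policy M \<pi>" "a \<in> actions M t h"
  shows "is_policy M (deviation \<pi> t h a)"
  using assms by (auto simp: is_policy_def deviation_def)

section \<open>Kernels that attain the one-step infima\<close>

context event_tree
begin

text \<open>Compactness turns a one-step infimum into a minimum: the expectation of \<open>f\<close> depends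
  continuously on the mass function, because it involves finitely many of its values.\<close>

lemma worst_kernel_exists:
  fixes f :: "'y \<Rightarrow> real"
  assumes "s \<le> t" "t < horizon M" "h \<in> histories M t" "a \<in> actions M t h"
  shows "\<exists>q. is_arg_min (\<lambda>q. \<Sum>y\<in>observations M (Suc t) h a. pmf q y * f y)
    (\<lambda>q. q \<in> kernels M s t h a) q"
proof -
  have "continuous_on (pmf ` kernels M s t h a)
      (\<lambda>p. \<Sum>y\<in>observations M (Suc t) h a. p y * f y)"
    by (intro continuous_intros continuous_on_product_coordinates
        continuous_on_subset[OF continuous_on_product_coordinates]) auto
  then obtain p where "p \<in> pmf ` kernels M s t h a" and
    "\<forall>p'\<in>pmf ` kernels M s t h a. (\<Sum>y\<in>observations M (Suc t) h a. p y * f y) \<le>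
      (\<Sum>y\<in>observations M (Suc t) h a. p' y * f y)"
    using continuous_attains_inf[OF kernels_compact[OF assms]] kernels_nonempty[OF assms]
    by blast
  then show ?thesis
    unfolding is_arg_min_linorder by auto
qed

text \<open>The choice depends on the date and the history only, not on where an evaluation starts, so the
  same selection \<open>worst_kernel \<sigma> s\<close> serves the evaluations at all histories.\<close>

definition worst_kernel ::
    "('x, 'a, 'y) policy \<Rightarrow> nat \<Rightarrow> nat \<Rightarrow> ('x, 'a, 'y) history \<Rightarrow> 'y pmf" where
  "worst_kernel \<sigma> s t h = (SOME q. is_arg_min
    (\<lambda>q. \<Sum>y\<in>observations M (Suc t) h (\<sigma> t h). pmf q y * V M \<sigma> s (Suc t) (Node h (\<sigma> t h) y))
    (\<lambda>q. q \<in> kernels M s t h (\<sigma> t h)) q)"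

lemma worst_kernel:
  assumes "is_policy M \<sigma>" "s \<le> t" "t < horizon M" "h \<in> histories M t"
  shows "worst_kernel \<sigma> s t h \<in> kernels M s t h (\<sigma> t h)"
    and "q' \<in> kernels M s t h (\<sigma> t h) \<Longrightarrow>
      (\<Sum>y\<in>observations M (Suc t) h (\<sigma> t h).
        pmf (worst_kernel \<sigma> s t h) y * V M \<sigma> s (Suc t) (Node h (\<sigma> t h) y)) \<le>
      (\<Sum>y\<in>observations M (Suc t) h (\<sigma> t h). pmf q' y * V M \<sigma> s (Suc t) (Node h (\<sigma> t h) y))"
proof -
  let ?c = "\<lambda>q. \<Sum>y\<in>observations M (Suc t) h (\<sigma> t h).
    pmf q y * V M \<sigma> s (Suc t) (Node h (\<sigma> t h) y)"
  have a: "\<sigma> t h \<in> actions M t h"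
    using assms by (simp add: is_policy_def)
  have "is_arg_min ?c (\<lambda>q. q \<in> kernels M s t h (\<sigma> t h)) (worst_kernel \<sigma> s t h)"
    unfolding worst_kernel_def by (rule someI_ex[OF worst_kernel_exists[OF assms(2-4) a]])
  then show "worst_kernel \<sigma> s t h \<in> kernels M s t h (\<sigma> t h)"
    and "q' \<in> kernels M s t h (\<sigma> t h) \<Longrightarrow> ?c (worst_kernel \<sigma> s t h) \<le> ?c q'"
    unfolding is_arg_min_linorder by auto
qed

lemma V_worst_kernel:
  assumes "is_policy M \<sigma>" "s \<le> t" "t < horizon M" "h \<in> histories M t"
  shows "V M \<sigma> s t h = reward M t h (\<sigma> t h) + discount M *
    (\<Sum>y\<in>observations M (Suc t) h (\<sigma> t h).
      pmf (worst_kernel \<sigma> s t h) y * V M \<sigma> s (Suc t) (Node h (\<sigma> t h) y))"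
proof -
  let ?c = "\<lambda>q. \<Sum>y\<in>observations M (Suc t) h (\<sigma> t h).
    pmf q y * V M \<sigma> s (Suc t) (Node h (\<sigma> t h) y)"
  have "(INF q\<in>kernels M s t h (\<sigma> t h). ?c q) = ?c (worst_kernel \<sigma> s t h)"
  proof (rule cInf_eq_minimum)
    show "?c (worst_kernel \<sigma> s t h) \<in> ?c ` kernels M s t h (\<sigma> t h)"
      by (rule imageI[OF worst_kernel(1)[OF assms]])
    show "?c (worst_kernel \<sigma> s t h) \<le> v" if "v \<in> ?c ` kernels M s t h (\<sigma> t h)" for v
      using that worst_kernel(2)[OF assms] by (elim imageE) simp
  qed
  then show ?thesis
    using assms(3) by (subst V.simps) simp
qed

section \<open>Expected rewards of a selection\<close>

text \<open>Finite support makes every path reward integrable, which the linearity of expectations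
  requires.\<close>

lemma finite_path_law:
  assumes "is_policy M \<sigma>" "s \<le> t" "t + n \<le> horizon M" "h \<in> histories M t"
    and "\<kappa> \<in> selections M s t h \<sigma>"
  shows "finite (set_pmf (path_law \<sigma> \<kappa> n t h))"
  using assms(2-)
proof (induction n arbitrary: t h)
  case 0
  then show ?case by simp
next
  case (Suc n)
  have t: "t < horizon M"
    using Suc.prems by simp
  have a: "\<sigma> t h \<in> actions M t h"
    using assms(1) t Suc.prems(3) by (simp add: is_policy_def)
  have sub: "set_pmf (\<kappa> t h) \<subseteq> observations M (Suc t) h (\<sigma> t h)"
    using kernels_support[OF Suc.prems(1) t Suc.prems(3) a selections_kernel[OF Suc.prems(4) t]] .
  have "finite (set_pmf (\<kappa> t h))"
    using finite_subset[OF sub finite_observations[OF t Suc.prems(3) a]] .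
  moreover have "finite (set_pmf (path_law \<sigma> \<kappa> n (Suc t) (Node h (\<sigma> t h) y)))"
    if "y \<in> set_pmf (\<kappa> t h)" for y
  proof (rule Suc.IH)
    show "Node h (\<sigma> t h) y \<in> histories M (Suc t)"
      using successor[OF t Suc.prems(3) a] sub that by auto
    show "\<kappa> \<in> selections M s (Suc t) (Node h (\<sigma> t h) y) \<sigma>"
      using selections_successor[OF Suc.prems(4) t a] sub that by auto
  qed (use Suc.prems in auto)
  ultimately show ?case
    by simp
qed

text \<open>Conditioning on the first observation: the path reward splits into the current reward, which is
  constant along the path law, and the discounted reward of the tail. The result is the recursion of
  \<open>V\<close> with the selected kernel in place of the infimum.\<close>

lemma expected_reward_rec:
  assumes "is_policy M \<sigma>" "s \<le> t" "t < horizon M" "h \<in> histories M t"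
    and "\<kappa> \<in> selections M s t h \<sigma>"
  shows "expected_reward M \<sigma> \<kappa> t h = reward M t h (\<sigma> t h) + discount M *
    (\<Sum>y\<in>observations M (Suc t) h (\<sigma> t h).
      pmf (\<kappa> t h) y * expected_reward M \<sigma> \<kappa> (Suc t) (Node h (\<sigma> t h) y))"
proof -
  define Y where "Y = observations M (Suc t) h (\<sigma> t h)"
  define P where "P y = path_law \<sigma> \<kappa> (horizon M - Suc t) (Suc t) (Node h (\<sigma> t h) y)" for y
  have a: "\<sigma> t h \<in> actions M t h"
    using assms by (simp add: is_policy_def)
  have sub: "set_pmf (\<kappa> t h) \<subseteq> Y"
    unfolding Y_def
    using kernels_support[OF assms(2-4) a selections_kernel[OF assms(5,3)]] .
  have finY: "finite Y"
    unfolding Y_def using finite_observations[OF assms(3,4) a] .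
  have finP: "finite (set_pmf (P y))" if "y \<in> Y" for y
    unfolding P_def
  proof (rule finite_path_law[OF assms(1)])
    show "s \<le> Suc t" "Suc t + (horizon M - Suc t) \<le> horizon M"
      using assms(2,3) by auto
    show "Node h (\<sigma> t h) y \<in> histories M (Suc t)"
      using successor[OF assms(3,4) a] that by (simp add: Y_def)
    show "\<kappa> \<in> selections M s (Suc t) (Node h (\<sigma> t h) y) \<sigma>"
      using selections_successor[of \<kappa>, OF assms(5,3) a] that by (simp add: Y_def)
  qed
  have tail: "measure_pmf.expectation (map_pmf ((#) h) (P y)) (path_reward M \<sigma> t) =
      reward M t h (\<sigma> t h) + discount M * expected_reward M \<sigma> \<kappa> (Suc t) (Node h (\<sigma> t h) y)"
    if "y \<in> Y" for y
  proof -
    have "integrable (measure_pmf (P y)) (path_reward M \<sigma> (Suc t))"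
      using integrable_measure_pmf_finite[OF finP[OF that]] .
    then show ?thesis
      by (simp add: path_reward_Cons[OF assms(3)] expected_reward_def flip: P_def)
  qed
  have "horizon M - t = Suc (horizon M - Suc t)"
    using assms(3) by simp
  then have "expected_reward M \<sigma> \<kappa> t h =
      measure_pmf.expectation (\<kappa> t h \<bind> (\<lambda>y. map_pmf ((#) h) (P y))) (path_reward M \<sigma> t)"
    by (simp add: expected_reward_def P_def)
  also have "\<dots> = (\<Sum>y\<in>Y. pmf (\<kappa> t h) y *
      measure_pmf.expectation (map_pmf ((#) h) (P y)) (path_reward M \<sigma> t))"
    by (subst pmf_expectation_bind[OF finY _ sub]) (simp_all add: finP)
  also have "\<dots> = (\<Sum>y\<in>Y. pmf (\<kappa> t h) y * (reward M t h (\<sigma> t h) + discount M *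
      expected_reward M \<sigma> \<kappa> (Suc t) (Node h (\<sigma> t h) y)))"
    by (simp only: tail cong: sum.cong)
  also have "\<dots> = (\<Sum>y\<in>Y. pmf (\<kappa> t h) y) * reward M t h (\<sigma> t h) + discount M *
      (\<Sum>y\<in>Y. pmf (\<kappa> t h) y * expected_reward M \<sigma> \<kappa> (Suc t) (Node h (\<sigma> t h) y))"
    by (simp add: sum_distrib_left sum_distrib_right sum.distrib algebra_simps)
  also have "(\<Sum>y\<in>Y. pmf (\<kappa> t h) y) = 1"
    using sum_pmf_eq_1[OF finY sub] .
  finally show ?thesis
    by (simp add: Y_def)
qed

section \<open>Backward induction\<close>

lemma expected_reward_horizon: "expected_reward M \<sigma> \<kappa> (horizon M) h = final_reward M h"
  by (simp add: expected_reward_def path_reward_def)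

lemma V_horizon: "V M \<sigma> s (horizon M) h = final_reward M h"
  by (simp add: V.simps)

lemma V_le_expected_reward:
  assumes "is_policy M \<sigma>" "s \<le> t" "t \<le> horizon M" "h \<in> histories M t"
    and "\<kappa> \<in> selections M s t h \<sigma>"
  shows "V M \<sigma> s t h \<le> expected_reward M \<sigma> \<kappa> t h"
  using assms(3,2,4,5)
proof (induction arbitrary: h rule: inc_induct)
  case base
  then show ?case
    by (simp add: expected_reward_horizon V_horizon)
next
  case (step t)
  note t = step.hyps(2)
  have a: "\<sigma> t h \<in> actions M t h"
    using assms(1) t step.prems(2) by (simp add: is_policy_def)
  have IH: "V M \<sigma> s (Suc t) (Node h (\<sigma> t h) y) \<le>
      expected_reward M \<sigma> \<kappa> (Suc t) (Node h (\<sigma> t h) y)"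
    if "y \<in> observations M (Suc t) h (\<sigma> t h)" for y
  proof (rule step.IH)
    show "s \<le> Suc t"
      using step.prems(1) by simp
    show "Node h (\<sigma> t h) y \<in> histories M (Suc t)"
      using successor[OF t step.prems(2) a that] .
    show "\<kappa> \<in> selections M s (Suc t) (Node h (\<sigma> t h) y) \<sigma>"
      using selections_successor[OF step.prems(3) t a that] .
  qed
  \<comment> \<open>An excess over \<open>V\<close> can arise twice: the kernel selected at \<open>h\<close> need not be minimal, and neither
    need the kernels selected later on.\<close>
  note worst_kernel(2)[OF assms(1) step.prems(1) t step.prems(2)
    selections_kernel[OF step.prems(3) t]]
  also have "(\<Sum>y\<in>observations M (Suc t) h (\<sigma> t h).
        pmf (\<kappa> t h) y * V M \<sigma> s (Suc t) (Node h (\<sigma> t h) y)) \<le>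
      (\<Sum>y\<in>observations M (Suc t) h (\<sigma> t h).
        pmf (\<kappa> t h) y * expected_reward M \<sigma> \<kappa> (Suc t) (Node h (\<sigma> t h) y))"
    by (intro sum_mono mult_left_mono IH) auto
  finally have "(\<Sum>y\<in>observations M (Suc t) h (\<sigma> t h).
        pmf (worst_kernel \<sigma> s t h) y * V M \<sigma> s (Suc t) (Node h (\<sigma> t h) y)) \<le>
      (\<Sum>y\<in>observations M (Suc t) h (\<sigma> t h).
        pmf (\<kappa> t h) y * expected_reward M \<sigma> \<kappa> (Suc t) (Node h (\<sigma> t h) y))" .
  then show ?case
    unfolding V_worst_kernel[OF assms(1) step.prems(1) t step.prems(2)]
      expected_reward_rec[OF assms(1) step.prems(1) t step.prems(2,3)]
    by (intro add_left_mono mult_left_mono less_imp_le[OF discount_pos])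
qed

lemma descendants_histories:
  assumes "(j, h') \<in> descendants M t h" "h \<in> histories M t"
  shows "h' \<in> histories M j"
  using assms
  by (induction rule: descendants.induct) (auto intro: successor)

text \<open>Rectangularity enters here: kernels may be chosen history by history, with no constraint linking
  the choices, so the one-step minimisers together form an admissible selection.\<close>

lemma worst_kernel_selection:
  assumes "is_policy M \<sigma>" "s \<le> t" "h \<in> histories M t"
  shows "worst_kernel \<sigma> s \<in> selections M s t h \<sigma>"
proof -
  have "t \<le> j" if "(j, h') \<in> descendants M t h" for j h'
    using that by (induction rule: descendants.induct) auto
  then show ?thesis
    using assms descendants_histories
    by (fastforce simp: selections_def intro: worst_kernel(1))
qed

lemma expected_reward_worst_kernel:
  assumes "is_policy M \<sigma>" "s \<le> t" "t \<le> horizon M" "h \<in> histories M t"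
  shows "expected_reward M \<sigma> (worst_kernel \<sigma> s) t h = V M \<sigma> s t h"
  using assms(3,2,4)
proof (induction arbitrary: h rule: inc_induct)
  case base
  then show ?case
    by (simp add: expected_reward_horizon V_horizon)
next
  case (step t)
  note t = step.hyps(2)
  have a: "\<sigma> t h \<in> actions M t h"
    using assms(1) t step.prems(2) by (simp add: is_policy_def)
  have IH: "expected_reward M \<sigma> (worst_kernel \<sigma> s) (Suc t) (Node h (\<sigma> t h) y) =
      V M \<sigma> s (Suc t) (Node h (\<sigma> t h) y)" if "y \<in> observations M (Suc t) h (\<sigma> t h)" for y
    using step.prems successor[OF t step.prems(2) a that] by (intro step.IH) auto
  show ?case
    unfolding expected_reward_rec[OF assms(1) step.prems(1) t step.prems(2)
        worst_kernel_selection[OF assms(1) step.prems]]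
      V_worst_kernel[OF assms(1) step.prems(1) t step.prems(2)]
    by (simp add: IH)
qed

theorem robust_evaluation_eq_V:
  assumes "is_policy M \<sigma>" "s \<le> t" "t \<le> horizon M" "h \<in> histories M t"
  shows "robust_evaluation M s t h \<sigma> = V M \<sigma> s t h"
  unfolding robust_evaluation_def expected_reward_def[symmetric]
proof (rule cInf_eq_minimum)
  show "V M \<sigma> s t h \<in> (\<lambda>\<kappa>. expected_reward M \<sigma> \<kappa> t h) ` selections M s t h \<sigma>"
    by (intro image_eqI[where x = "worst_kernel \<sigma> s"])
      (simp_all add: expected_reward_worst_kernel[OF assms] worst_kernel_selection[OF assms(1,2,4)])
next
  fix v
  assume "v \<in> (\<lambda>\<kappa>. expected_reward M \<sigma> \<kappa> t h) ` selections M s t h \<sigma>"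
  then show "V M \<sigma> s t h \<le> v"
    using V_le_expected_reward[OF assms] by (elim imageE) simp
qed

corollary robust_evaluation_deviation:
  assumes "is_policy M \<pi>" "s \<le> t" "t < horizon M" "h \<in> histories M t" "a \<in> actions M t h"
  shows "robust_evaluation M s t h (deviation \<pi> t h a) = Q M \<pi> s t h a"
  using robust_evaluation_eq_V[OF is_policy_deviation[OF assms(1,5)] assms(2) _ assms(4)]
    V_deviation[OF assms(3)] assms(3) by simp

end

section \<open>Equilibria as one-step maximisers\<close>

theorem theorem6p3:
  fixes M :: "('x, 'a, 'y) ambiguity_model" and \<pi> :: "('x, 'a, 'y) policy"
  assumes "event_tree M" and "is_policy M \<pi>"
  shows "SPE M \<pi> \<longleftrightarrow>
    (\<forall>t<horizon M. \<forall>h\<in>histories M t.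
      is_arg_max (\<lambda>a. Q M \<pi> t t h a) (\<lambda>a. a \<in> actions M t h) (\<pi> t h))"
proof -
  interpret event_tree M by fact
  have "is_arg_max (\<lambda>a. robust_evaluation M t t h (deviation \<pi> t h a)) (\<lambda>a. a \<in> actions M t h) (\<pi> t h)
      \<longleftrightarrow> is_arg_max (\<lambda>a. Q M \<pi> t t h a) (\<lambda>a. a \<in> actions M t h) (\<pi> t h)"
    if "t < horizon M" "h \<in> histories M t" for t h
    using robust_evaluation_deviation[OF assms(2) order.refl that]
    by (simp add: is_arg_max_linorder cong: conj_cong)
  then show ?thesis
    by (simp add: SPE_def)
qed

end
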